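(* Let $(X,\tau)$ be a topological space, $\eta$ an almost proximity on $X$, $\delta$ a Lodato proximity on $X$ compatible with $\tau$, and $\mathscr{B}$ a non-empty subfamily of $\mathrm{RCL}(X)$. If $\Sigma(\mathscr{B})$ is a regular local family, then $(\mathrm{RCL}(X),\tau^{\mathrm{sn}}_{\mathscr{B}})$, where $\tau^{\mathrm{sn}}_{\mathscr{B}}$ is the strongly hit and far-miss topology associated with $\mathscr{B}$, is $T_2$ (Hausdorff).
   Context: A set $F\subseteq X$ is regular closed if $F=\operatorname{cl}(\operatorname{int}F)$, and $A\subseteq X$ is regular open if $A=\operatorname{int}(\operatorname{cl}A)$. $\mathrm{RCL}(X)$ is the set of all regular closed subsets of $X$. A Lodato proximity on a nonempty set $X$ is a relation $\delta$ on the power set $\mathscr{P}(X)$ such that for all $A,B,C\subseteq X$: (P0) $A\,\delta\,B \Rightarrow B\,\delta\,A$; (P1) $A\,\delta\,B \Rightarrow A\neq\emptyset$ and $B\neq\emptyset$; (P2) $A\cap B\neq\emptyset \Rightarrow A\,\delta\,B$; (P3) $A\,\delta\,(B\cup C) \Leftrightarrow A\,\delta\,B$ or $A\,\delta\,C$; (P4) if $A\,\delta\,B$ and $\{b\}\,\delta\,C$ for each $b\in B$, then $A\,\delta\,C$. Write $A\not\delta B$ for the negation of $A\,\delta\,B$. The proximity $\delta$ is compatible with $\tau$ if for every $A\subseteq X$ the $\tau$-closure of $A$ equals $\{x\in X:\{x\}\,\delta\,A\}$. A strongly near proximity on the topological space $X$ is a relation $\eta$ on $\mathscr{P}(X)$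 such that for all $A,B,C\subseteq X$: (N0) $\emptyset\,\eta\,A$ never holds, and $X\,\eta\,A$ holds for every non-empty $A$; (N1) $A\,\eta\,B\Leftrightarrow B\,\eta\,A$; (N2) $A\,\eta\,B\Rightarrow A\cap B\neq\emptyset$; (N3) if $\operatorname{int}B\neq\emptyset$ and $\operatorname{int}C\neq\emptyset$, then ($A\,\eta\,B$ or $A\,\eta\,C$) implies $A\,\eta\,(B\cup C)$; (N4) $\operatorname{int}A\cap\operatorname{int}B\neq\emptyset\Rightarrow A\,\eta\,B$. An almost proximity is a strongly near proximity satisfying in addition, for all $x,y\in X$ and $A\subseteq X$: (N5) $x\in\operatorname{int}A\Rightarrow\{x\}\,\eta\,A$; (N6) $\{x\}\,\eta\,\{y\}\Leftrightarrow x=y$. The topology $\tau^{\mathrm{sn}}_{\mathscr{B}}$ on $\mathrm{RCL}(X)$ is the one having as a subbase all sets of the following two forms: (i) $\{E\in\mathrm{RCL}(X): E\,\eta\,V\}$, where $V$ is a regular open subset of $X$; (ii) $A^{++}=\{E\in\mathrm{RCL}(X): E\not\delta (X\setminus A)\}$, where $A$ is a regular open subset of $X$ with $X\setminus A\in\mathscr{B}$. $\Sigma(\mathscr{B})$ denotes the collection of all finite unions of elements of $\mathscr{B}$. A non-empty family $\mathscr{S}$ of subsets of $X$ is a regular local family if for every $x\in X$ and every regular open set $U$ containing $x$ there exists $S\in\mathscr{S}$ such that $x\in\operatorname{int}(S)$ and $S\not\delta (X\setminus U)$. *)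

theory Defs
  imports "HOL-Analysis.Analysis"
begin

text \<open>
  A topological space is a \<open>T :: 'a topology\<close> with underlying set \<open>X = topspace T\<close>.
  Relations on the power set of \<open>X\<close> are binary predicates on \<open>'a set\<close>; all axioms
  range over subsets of \<open>X\<close> only, so values on other sets are irrelevant.
\<close>

definition regular_closedin :: "'a topology \<Rightarrow> 'a set \<Rightarrow> bool" where
  "regular_closedin T F \<longleftrightarrow> F \<subseteq> topspace T \<and> F = T closure_of (T interior_of F)"

definition regular_openin :: "'a topology \<Rightarrow> 'a set \<Rightarrow> bool" where
  "regular_openin T A \<longleftrightarrow> A \<subseteq> topspace T \<and> A = T interior_of (T closure_of A)"

definition RCL :: "'a topology \<Rightarrow> 'a set set" where
  "RCL T = {F. regular_closedin T F}"

locale lodato_proximity =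
  fixes X :: "'a set" and \<delta> :: "'a set \<Rightarrow> 'a set \<Rightarrow> bool"
  assumes carrier_nonempty: "X \<noteq> {}"
    and P0: "\<lbrakk>A \<subseteq> X; B \<subseteq> X; \<delta> A B\<rbrakk> \<Longrightarrow> \<delta> B A"
    and P1: "\<lbrakk>A \<subseteq> X; B \<subseteq> X; \<delta> A B\<rbrakk> \<Longrightarrow> A \<noteq> {} \<and> B \<noteq> {}"
    and P2: "\<lbrakk>A \<subseteq> X; B \<subseteq> X; A \<inter> B \<noteq> {}\<rbrakk> \<Longrightarrow> \<delta> A B"
    and P3: "\<lbrakk>A \<subseteq> X; B \<subseteq> X; C \<subseteq> X\<rbrakk> \<Longrightarrow> \<delta> A (B \<union> C) \<longleftrightarrow> \<delta> A B \<or> \<delta> A C"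
    and P4: "\<lbrakk>A \<subseteq> X; B \<subseteq> X; C \<subseteq> X; \<delta> A B; \<forall>b\<in>B. \<delta> {b} C\<rbrakk> \<Longrightarrow> \<delta> A C"

definition compatible_proximity :: "'a topology \<Rightarrow> ('a set \<Rightarrow> 'a set \<Rightarrow> bool) \<Rightarrow> bool" where
  "compatible_proximity T \<delta> \<longleftrightarrow>
     (\<forall>A \<subseteq> topspace T. T closure_of A = {x \<in> topspace T. \<delta> {x} A})"

locale strongly_near_proximity =
  fixes T :: "'a topology" and \<eta> :: "'a set \<Rightarrow> 'a set \<Rightarrow> bool"
  assumes N0_empty: "A \<subseteq> topspace T \<Longrightarrow> \<not> \<eta> {} A"
    and N0_space: "\<lbrakk>A \<subseteq> topspace T; A \<noteq> {}\<rbrakk> \<Longrightarrow> \<eta> (topspace T) A"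
    and N1: "\<lbrakk>A \<subseteq> topspace T; B \<subseteq> topspace T\<rbrakk> \<Longrightarrow> \<eta> A B \<longleftrightarrow> \<eta> B A"
    and N2: "\<lbrakk>A \<subseteq> topspace T; B \<subseteq> topspace T; \<eta> A B\<rbrakk> \<Longrightarrow> A \<inter> B \<noteq> {}"
    and N3: "\<lbrakk>A \<subseteq> topspace T; B \<subseteq> topspace T; C \<subseteq> topspace T;
              T interior_of B \<noteq> {}; T interior_of C \<noteq> {}; \<eta> A B \<or> \<eta> A C\<rbrakk>
             \<Longrightarrow> \<eta> A (B \<union> C)"
    and N4: "\<lbrakk>A \<subseteq> topspace T; B \<subseteq> topspace T; T interior_of A \<inter> T interior_of B \<noteq> {}\<rbrakk>
             \<Longrightarrow> \<eta> A B"

locale almost_proximity = strongly_near_proximity +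
  assumes N5: "\<lbrakk>A \<subseteq> topspace T; x \<in> T interior_of A\<rbrakk> \<Longrightarrow> \<eta> {x} A"
    and N6: "\<lbrakk>x \<in> topspace T; y \<in> topspace T\<rbrakk> \<Longrightarrow> \<eta> {x} {y} \<longleftrightarrow> x = y"

definition strong_hit :: "'a topology \<Rightarrow> ('a set \<Rightarrow> 'a set \<Rightarrow> bool) \<Rightarrow> 'a set \<Rightarrow> 'a set set" where
  "strong_hit T \<eta> V = {E \<in> RCL T. \<eta> E V}"

definition far_miss :: "'a topology \<Rightarrow> ('a set \<Rightarrow> 'a set \<Rightarrow> bool) \<Rightarrow> 'a set \<Rightarrow> 'a set set" where
  "far_miss T \<delta> A = {E \<in> RCL T. \<not> \<delta> E (topspace T - A)}"

text \<open>
  \<^const>\<open>topology_generated_by\<close> takes the union of the generating family as the underlying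
  set. Inserting \<^term>\<open>RCL T\<close>, the empty intersection, makes the underlying set
  \<^term>\<open>RCL T\<close> for all arguments and adds no other open set.
\<close>

definition sn_hit_far_miss_topology ::
    "'a topology \<Rightarrow> ('a set \<Rightarrow> 'a set \<Rightarrow> bool) \<Rightarrow> ('a set \<Rightarrow> 'a set \<Rightarrow> bool) \<Rightarrow> 'a set set
      \<Rightarrow> 'a set topology" where
  "sn_hit_far_miss_topology T \<eta> \<delta> \<B> = topology_generated_by (insert (RCL T)
     ({strong_hit T \<eta> V | V. regular_openin T V} \<union>
      {far_miss T \<delta> A | A. regular_openin T A \<and> topspace T - A \<in> \<B>}))"

lemma topspace_sn_hit_far_miss_topology [simp]:
  "topspace (sn_hit_far_miss_topology T \<eta> \<delta> \<B>) = RCL T"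
  by (auto simp: sn_hit_far_miss_topology_def strong_hit_def far_miss_def)

definition finite_unions :: "'a set set \<Rightarrow> 'a set set" where
  "finite_unions \<B> = {\<Union>\<F> | \<F>. finite \<F> \<and> \<F> \<subseteq> \<B>}"

definition regular_local_family ::
    "'a topology \<Rightarrow> ('a set \<Rightarrow> 'a set \<Rightarrow> bool) \<Rightarrow> 'a set set \<Rightarrow> bool" where
  "regular_local_family T \<delta> \<S> \<longleftrightarrow>
     \<S> \<noteq> {} \<and> (\<forall>S\<in>\<S>. S \<subseteq> topspace T) \<and>
     (\<forall>x\<in>topspace T. \<forall>U. regular_openin T U \<and> x \<in> U \<longrightarrow>
        (\<exists>S\<in>\<S>. x \<in> T interior_of S \<and> \<not> \<delta> S (topspace T - U)))"

end

theory Submission imports Defs begin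

text \<open>
  If \<open>E \<noteq> F\<close> are regular closed then, up to symmetry, some \<open>x\<close> lies in the interior of \<open>E\<close>
  but not in \<open>F\<close>. The local family yields a finite union \<open>S\<close> of members of \<open>\<B>\<close> that is far
  from \<open>F\<close> with \<open>x\<close> in its interior. Sets far from every summand of \<open>S\<close> miss \<open>S\<close>, while sets
  strongly near the regular open set \<open>int S\<close> meet \<open>S\<close>; these two open conditions separate
  \<open>F\<close> from \<open>E\<close>.
\<close>

text \<open>As \<open>S\<close> is closed, the closure of its interior stays inside
  \<open>S\<close>; taking interiors again adds nothing.\<close>

lemma regular_openin_interior_of_closedin:
  assumes "closedin T S"
  shows "regular_openin T (T interior_of S)"
proof -
  have "T closure_of (T interior_of S) \<subseteq> S"
    by (simp add: assms closure_of_minimal interior_of_subset)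
  then have "T interior_of (T closure_of (T interior_of S)) \<subseteq> T interior_of S"
    by (rule interior_of_mono)
  moreover have "T interior_of S \<subseteq> T interior_of (T closure_of (T interior_of S))"
    by (simp add: interior_of_maximal closure_of_subset interior_of_subset_topspace)
  ultimately show ?thesis
    unfolding regular_openin_def by (intro conjI interior_of_subset_topspace equalityI)
qed

lemma closure_of_interior_of_regular_closedin:
  assumes "regular_closedin T F"
  shows "T closure_of (T interior_of F) = F"
  by (rule sym) (rule assms[unfolded regular_closedin_def, THEN conjunct2])

lemma closedin_regular_closedin:
  assumes "regular_closedin T F"
  shows "closedin T F"
  using closedin_closure_of[of T "T interior_of F"]
  by (simp only: closure_of_interior_of_regular_closedin[OF assms])

text \<open>Complementation exchanges closure and interior. This makes complements of members of
  \<open>\<B>\<close> admissible in \<open>far_miss\<close>.\<close>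

lemma regular_openin_Diff:
  assumes "regular_closedin T F"
  shows "regular_openin T (topspace T - F)"
  using closure_of_interior_of_regular_closedin[OF assms]
  by (simp add: regular_openin_def closure_of_complement interior_of_complement)

text \<open>A regular closed set is the closure of its interior, so a closed set containing the
  interior contains it all. Contraposed, this yields interior points of \<open>E\<close> outside
  \<open>F\<close>.\<close>

lemma regular_closedin_subset_iff_interior:
  assumes "regular_closedin T E" "closedin T F"
  shows "E \<subseteq> F \<longleftrightarrow> T interior_of E \<subseteq> F"
proof
  assume "T interior_of E \<subseteq> F"
  then have "T closure_of (T interior_of E) \<subseteq> F"
    using assms(2) by (rule closure_of_minimal)
  then show "E \<subseteq> F"
    using closure_of_interior_of_regular_closedin[OF assms(1)] by simp
qed (rule order_trans[OF interior_of_subset])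

text \<open>Monotonicity is hidden in P3, since \<open>B \<union> C\<close> is \<open>C\<close> when
  \<open>B \<subseteq> C\<close>.\<close>

lemma (in lodato_proximity) mono_right:
  assumes "\<delta> A B" "B \<subseteq> C" "A \<subseteq> X" "C \<subseteq> X"
  shows "\<delta> A C"
proof -
  have "\<delta> A (B \<union> C)"
    using assms P3 by blast
  then show ?thesis
    using assms(2) by (simp add: sup.absorb2)
qed

lemma openin_strong_hit:
  assumes "regular_openin T V"
  shows "openin (sn_hit_far_miss_topology T \<eta> \<delta> \<B>) (strong_hit T \<eta> V)"
  unfolding sn_hit_far_miss_topology_def
  by (rule topology_generated_by_Basis) (use assms in auto)

lemma openin_far_miss:
  assumes "regular_openin T A" "topspace T - A \<in> \<B>"
  shows "openin (sn_hit_far_miss_topology T \<eta> \<delta> \<B>) (far_miss T \<delta> A)"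
  unfolding sn_hit_far_miss_topology_def
  by (rule topology_generated_by_Basis) (use assms in auto)

lemma sn_hit_far_miss_separation:
  assumes "almost_proximity T \<eta>"
    and "lodato_proximity (topspace T) \<delta>"
    and "\<B> \<subseteq> RCL T"
    and "regular_local_family T \<delta> (finite_unions \<B>)"
    and "E \<in> RCL T" "F \<in> RCL T" "\<not> E \<subseteq> F"
  obtains U W where "openin (sn_hit_far_miss_topology T \<eta> \<delta> \<B>) U"
    "openin (sn_hit_far_miss_topology T \<eta> \<delta> \<B>) W" "E \<in> U" "F \<in> W" "disjnt U W"
proof -
  interpret almost_proximity T \<eta> by fact
  interpret lodato_proximity "topspace T" \<delta> by fact
  let ?H = "sn_hit_far_miss_topology T \<eta> \<delta> \<B>"
  have sub: "G \<subseteq> topspace T" if "G \<in> RCL T" for G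
    using that by (simp add: RCL_def closedin_regular_closedin closedin_subset)
  have "\<not> T interior_of E \<subseteq> F"
    using assms(5-7) regular_closedin_subset_iff_interior closedin_regular_closedin
    unfolding RCL_def by blast
  then obtain x where x: "x \<in> T interior_of E" "x \<notin> F"
    by blast
  then have "x \<in> topspace T"
    using interior_of_subset_topspace[of T E] by blast
  \<comment> \<open>The local family is applied to the complement of \<open>F\<close>: being far
    from the complement of that set means being far from \<open>F\<close>.\<close>
  moreover have "regular_openin T (topspace T - F)"
    using assms(6) by (simp add: RCL_def regular_openin_Diff)
  ultimately obtain S where S: "S \<in> finite_unions \<B>" "x \<in> T interior_of S"
      and "\<not> \<delta> S (topspace T - (topspace T - F))"
    using assms(4) x(2) unfolding regular_local_family_def by (metis DiffI)
  then have far: "\<not> \<delta> S F"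
    using sub[OF assms(6)] by (simp add: double_diff)
  obtain \<F> where \<F>: "finite \<F>" "\<F> \<subseteq> \<B>" "S = \<Union>\<F>"
    using S(1) by (auto simp: finite_unions_def)
  have B: "B \<in> RCL T" "topspace T - (topspace T - B) = B" if "B \<in> \<F>" for B
    using that \<F>(2) assms(3) sub by (auto simp: double_diff)
  \<comment> \<open>Finiteness of \<open>\<F>\<close> makes \<open>S\<close> closed, hence its
    interior regular open.\<close>
  have "closedin T S"
    unfolding \<F>(3) using \<F>(1) B(1)
    by (intro closedin_Union) (auto simp: RCL_def closedin_regular_closedin)
  then have SX: "S \<subseteq> topspace T"
    by (rule closedin_subset)
  let ?V = "T interior_of S"
  let ?U = "strong_hit T \<eta> ?V"
  \<comment> \<open>The union \<open>S\<close> need not belong to \<open>\<B>\<close>, so the miss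
    condition is imposed on each summand. The factor \<open>topspace ?H\<close> spares a case split
    on empty \<open>\<F>\<close>.\<close>
  let ?W = "(\<Inter>B\<in>\<F>. far_miss T \<delta> (topspace T - B)) \<inter> topspace ?H"
  show ?thesis
  proof
    show "openin ?H ?U"
      using \<open>closedin T S\<close> by (intro openin_strong_hit regular_openin_interior_of_closedin)
    show "openin ?H ?W"
    proof (rule openin_INT)
      fix B assume "B \<in> \<F>"
      with B[OF this] \<F>(2) show "openin ?H (far_miss T \<delta> (topspace T - B))"
        by (intro openin_far_miss regular_openin_Diff) (auto simp: RCL_def)
    qed (fact \<F>(1))
    \<comment> \<open>The point \<open>x\<close> lies in both interiors, \<open>?V\<close> being
      open.\<close>
    have "\<eta> E ?V"
      by (rule N4) (use x(1) S(2) sub[OF assms(5)] in \<open>auto simp: interior_of_subset_topspace\<close>)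
    then show "E \<in> ?U"
      using assms(5) by (simp add: strong_hit_def)
    have "\<not> \<delta> F B" if "B \<in> \<F>" for B
    proof
      assume "\<delta> F B"
      then have "\<delta> F S"
        using that \<F>(3) SX sub[OF assms(6)] by (intro mono_right[of F B S]) auto
      then show False
        using far P0 SX sub[OF assms(6)] by blast
    qed
    then show "F \<in> ?W"
      using assms(6) B by (simp add: far_miss_def)
    have False if "G \<in> ?U" "G \<in> ?W" for G
    proof -
      have G: "G \<subseteq> topspace T" "\<eta> G ?V"
        using that(1) sub by (auto simp: strong_hit_def)
      \<comment> \<open>Strong nearness gives a common point, which lies in some summand
        \<open>B\<close>; by P2 the set \<open>G\<close> is then near \<open>B\<close>.\<close>
      then have "G \<inter> ?V \<noteq> {}"
        by (intro N2) (auto simp: interior_of_subset_topspace)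
      then obtain B where "B \<in> \<F>" "G \<inter> B \<noteq> {}"
        using interior_of_subset[of T S] \<F>(3) by blast
      then have "\<delta> G B"
        using G(1) B(1) sub by (intro P2) auto
      then show False
        using that(2) \<open>B \<in> \<F>\<close> B(2) by (auto simp: far_miss_def)
    qed
    then show "disjnt ?U ?W"
      by (auto simp only: disjnt_iff)
  qed
qed

theorem theorem4p7:
  fixes T :: "'a topology"
    and \<eta> \<delta> :: "'a set \<Rightarrow> 'a set \<Rightarrow> bool"
    and \<B> :: "'a set set"
  assumes "almost_proximity T \<eta>"
    and "lodato_proximity (topspace T) \<delta>"
    and "compatible_proximity T \<delta>"
    and "\<B> \<noteq> {}"
    and "\<B> \<subseteq> RCL T"
    and "regular_local_family T \<delta> (finite_unions \<B>)"
  shows "Hausdorff_space (sn_hit_far_miss_topology T \<eta> \<delta> \<B>)"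
  unfolding Hausdorff_space_def topspace_sn_hit_far_miss_topology
proof (intro allI impI, elim conjE)
  note separation = sn_hit_far_miss_separation[OF assms(1,2,5,6)]
  fix E F assume EF: "E \<in> RCL T" "F \<in> RCL T" "E \<noteq> F"
  then consider "\<not> E \<subseteq> F" | "\<not> F \<subseteq> E"
    by blast
  then show "\<exists>U V. openin (sn_hit_far_miss_topology T \<eta> \<delta> \<B>) U \<and>
      openin (sn_hit_far_miss_topology T \<eta> \<delta> \<B>) V \<and> E \<in> U \<and> F \<in> V \<and> disjnt U V"
  proof cases
    case 1
    then show ?thesis
      using separation[OF EF(1,2)] by metis
  next
    case 2
    then show ?thesis
      \<comment> \<open>Here \<open>F\<close> takes the hit set and \<open>E\<close> the miss set,
        so the two open sets are swapped back.\<close>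
      using separation[OF EF(2,1)] disjnt_sym by metis
  qed
qed

end
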